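(* Let $X=(X_A)_{A\in\mathcal A}$ be a set-indexed process with a unique additive extension to $\mathcal C(u)$ and let $(\mathcal F_A)_{A\in\mathcal A}$ be its minimal filtration. Then $X$ is set-Markov if and only if for every simple flow $f:[0,a]\to\mathcal A(u)$ the process $X^f=(X_{f(t)})_{t\in[0,a]}$ is Markov with respect to the filtration $(\mathcal F_{f(t)})_{t\in[0,a]}$, i.e. for all $s<t$ in $[0,a]$, $\mathcal F_{f(s)}$ and $\sigma(X_{f(t)})$ are conditionally independent given $\sigma(X_{f(s)})$. (For necessity one can consider any flow, not only simple ones: if $X$ is set-Markov then $X^f$ is Markov with respect to $(\mathcal F_{f(t)})_t$ for every flow $f$.)
   Context: Framework. $T$ is a compact Hausdorff space and $\mathcal A$ is a collection of closed connected subsets of $T$ with $\emptyset,T\in\mathcal A$, closed under arbitrary intersections, containing no two disjoint non-empty sets, and separable from above: there are finite subcollections $\mathcal A_n\subseteq\mathcal A_{n+1}\subseteq\mathcal A$ closed under intersections and maps $g_n$ sending each $A\in\mathcal A$ to a finite union of sets of $\mathcal A_n$ with $A=\cap_n g_n(A)$, $g_{n+1}(A)\subseteq g_n(A)$, $A\subseteq g_n(A)^0$ (interior), $g_n(\emptyset)=\emptyset$, $g_n(\cap_\alpha A_\alpha)=\cap_\alpha g_n(A_\alpha)$ for arbitrary families, and $\cup_{i=1}^kA_i=\cup_{j=1}^mA'_j\Rightarrow\cup_{i=1}^kg_n(A_i)=\cup_{j=1}^mg_n(A'_j)$. Put $\emptyset'=\cap_{A\in\mathcal A\setminus\{\emptyset\}}A$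 (a non-empty set). $\mathcal A(u)$ is the class of finite unions of sets of $\mathcal A$; $\mathcal C$ is the class of sets $A\setminus B$ with $A\in\mathcal A$, $B\in\mathcal A(u)$; $\mathcal C(u)$ is the class of finite unions of sets of $\mathcal C$. Flows. A flow is an increasing map $f:[0,a]\to\mathcal A(u)$ (or on any compact interval). It is continuous if $f(t)=\cap_nf(t_n)$ for $t_n\downarrow t$ and $f(t)=\overline{\cup_nf(t_n)}$ for $t_n\uparrow t$. It is simple if it is continuous and there are $0=t_0<\cdots<t_n=a$ and flows $f_{i+1}:[t_i,t_{i+1}]\to\mathcal A$ with $f(0)=\emptyset'$ and $f(t)=\cup_{j=1}^if_j(t_j)\cup f_{i+1}(t)$ for $t\in[t_i,t_{i+1}]$. Known fact of the framework (Ivanoff–Merzbach): for non-empty sets $B_1\subseteq\cdots\subseteq B_m$ in $\mathcal A(u)$ there exist a simple flow $f$ and $t_1\le\cdots\le t_m$ with $f(t_i)=B_i$. Processes. A process $X=(X_A)_{A\in\mathcal A}$ is a family of real random variables on a complete probability space. It has a (almost surely) unique additive extension to $\mathcal A(u)$ if, whenever $\cup_{i=1}^nA_i=\cup_{j=1}^mA'_j$ with all sets in $\mathcal A$, the inclusion–exclusion sums $\sum_iX_{A_i}-\sum_{i_1<i_2}X_{A_{i_1}\cap A_{i_2}}+\cdots+(-1)^{n+1}X_{A_1\cap\cdots\cap A_n}$ and the analogous sum for the $A'_j$ coincide a.s.; the common value is $X_B$, $B=\cup_iA_i$. It has a unique additive extension to $\mathcal C$ if $A\setminus B=A'\setminus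 B'$ ($A,A'\in\mathcal A$, $B,B'\in\mathcal A(u)$) implies $X_A-X_{A\cap B}=X_{A'}-X_{A'\cap B'}$ a.s., the common value being $X_{A\setminus B}$ (in particular $X_\emptyset=0$ a.s.). A unique additive extension to $\mathcal C(u)$ means the analogous inclusion–exclusion consistency for finite unions of sets of $\mathcal C$. The minimal filtration is $\mathcal F_B=\sigma(X_A;A\in\mathcal A,A\subseteq B)$, $B\in\mathcal A(u)$ (completed). $X$ is set-Markov if for all $A\in\mathcal A$ and $B\in\mathcal A(u)$, $\mathcal F_B$ and $\sigma(X_{A\setminus B})$ are conditionally independent given $\sigma(X_B)$. *)

theory Defs
  imports "HOL-Probability.Probability"
begin

section \<open>Indexing collections\<close>

text \<open>The empty union is allowed. This does not change the class as soon as \<open>{} \<in> \<S>\<close>.\<close>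

definition fin_unions :: "'t set set \<Rightarrow> 't set set" where
  "fin_unions \<S> = {\<Union>\<F> | \<F>. finite \<F> \<and> \<F> \<subseteq> \<S>}"

definition separable_from_above :: "'t::topological_space set set \<Rightarrow> bool" where
  "separable_from_above \<A> \<longleftrightarrow>
    (\<exists>(\<A>\<^sub>n :: nat \<Rightarrow> 't set set) (g :: nat \<Rightarrow> 't set \<Rightarrow> 't set).
      (\<forall>n. finite (\<A>\<^sub>n n) \<and> \<A>\<^sub>n n \<subseteq> \<A>\<^sub>n (Suc n) \<and> \<A>\<^sub>n n \<subseteq> \<A>) \<and>
      (\<forall>n. \<forall>A\<in>\<A>\<^sub>n n. \<forall>B\<in>\<A>\<^sub>n n. A \<inter> B \<in> \<A>\<^sub>n n) \<and>
      (\<forall>n. \<forall>A\<in>\<A>. g n A \<in> fin_unions (\<A>\<^sub>n n)) \<and>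
      (\<forall>A\<in>\<A>. A = (\<Inter>n. g n A)) \<and>
      (\<forall>n. \<forall>A\<in>\<A>. g (Suc n) A \<subseteq> g n A) \<and>
      (\<forall>n. \<forall>A\<in>\<A>. A \<subseteq> interior (g n A)) \<and>
      (\<forall>n. g n {} = {}) \<and>
      (\<forall>n. \<forall>\<S>\<subseteq>\<A>. \<S> \<noteq> {} \<longrightarrow> g n (\<Inter>\<S>) = (\<Inter>A\<in>\<S>. g n A)) \<and>
      (\<forall>n \<S> \<S>'. finite \<S> \<and> \<S> \<subseteq> \<A> \<and> finite \<S>' \<and> \<S>' \<subseteq> \<A> \<and> \<Union>\<S> = \<Union>\<S>' \<longrightarrow>
         (\<Union>A\<in>\<S>. g n A) = (\<Union>A\<in>\<S>'. g n A)))"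

text \<open>The space \<open>T\<close> is the whole type.\<close>

definition indexing_collection :: "'t::t2_space set set \<Rightarrow> bool" where
  "indexing_collection \<A> \<longleftrightarrow>
    compact (UNIV :: 't set) \<and>
    (\<forall>A\<in>\<A>. closed A \<and> connected A) \<and>
    {} \<in> \<A> \<and> UNIV \<in> \<A> \<and>
    (\<forall>\<S>\<subseteq>\<A>. \<S> \<noteq> {} \<longrightarrow> \<Inter>\<S> \<in> \<A>) \<and>
    (\<forall>A\<in>\<A>. \<forall>B\<in>\<A>. A \<noteq> {} \<and> B \<noteq> {} \<longrightarrow> A \<inter> B \<noteq> {}) \<and>
    separable_from_above \<A>"

definition empty' :: "'t set set \<Rightarrow> 't set" where
  "empty' \<A> = \<Inter>(\<A> - {{}})"

definition class_C :: "'t set set \<Rightarrow> 't set set" where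
  "class_C \<A> = {A - B | A B. A \<in> \<A> \<and> B \<in> fin_unions \<A>}"


section \<open>Flows\<close>

definition flow :: "'t set set \<Rightarrow> real \<Rightarrow> real \<Rightarrow> (real \<Rightarrow> 't set) \<Rightarrow> bool" where
  "flow \<S> a b f \<longleftrightarrow> a \<le> b \<and> f \<in> {a..b} \<rightarrow> \<S> \<and> mono_on {a..b} f"

definition continuous_flow ::
    "'t::topological_space set set \<Rightarrow> real \<Rightarrow> real \<Rightarrow> (real \<Rightarrow> 't set) \<Rightarrow> bool" where
  "continuous_flow \<S> a b f \<longleftrightarrow> flow \<S> a b f \<and>
    (\<forall>t\<in>{a..b}. \<forall>u. range u \<subseteq> {a..b} \<and> decseq u \<and> u \<longlonglongrightarrow> t \<longrightarrow> f t = (\<Inter>n. f (u n))) \<and>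
    (\<forall>t\<in>{a..b}. \<forall>u. range u \<subseteq> {a..b} \<and> incseq u \<and> u \<longlonglongrightarrow> t \<longrightarrow> f t = closure (\<Union>n. f (u n)))"

definition simple_flow :: "'t::topological_space set set \<Rightarrow> real \<Rightarrow> (real \<Rightarrow> 't set) \<Rightarrow> bool" where
  "simple_flow \<A> a f \<longleftrightarrow> continuous_flow (fin_unions \<A>) 0 a f \<and> f 0 = empty' \<A> \<and>
    (\<exists>(n::nat) (t :: nat \<Rightarrow> real) (h :: nat \<Rightarrow> real \<Rightarrow> 't set).
      0 < n \<and> t 0 = 0 \<and> t n = a \<and> (\<forall>i<n. t i < t (Suc i)) \<and>
      (\<forall>i<n. flow \<A> (t i) (t (Suc i)) (h (Suc i))) \<and>
      (\<forall>i<n. \<forall>s\<in>{t i..t (Suc i)}. f s = (\<Union>j\<in>{1..i}. h j (t j)) \<union> h (Suc i) s))"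

text \<open>
  Every finite increasing chain of non-empty sets of \<open>\<A>(u)\<close> lies on a simple flow. Ivanoff and
  Merzbach prove this in their framework. It is kept as a separate property because
  \<^const>\<open>indexing_collection\<close> alone does not imply it: for \<open>T = [0,1]\<close> and \<open>\<A>\<close> consisting of
  the empty set, \<open>T\<close> and the intervals \<open>[0,x]\<close> with \<open>x < 1/2\<close>, no simple flow reaches \<open>T\<close>.
\<close>

definition chains_on_simple_flows :: "'t::topological_space set set \<Rightarrow> bool" where
  "chains_on_simple_flows \<A> \<longleftrightarrow>
    (\<forall>(m::nat) (B :: nat \<Rightarrow> 't set).
      0 < m \<and> (\<forall>i<m. B i \<in> fin_unions \<A> \<and> B i \<noteq> {}) \<and> (\<forall>i. Suc i < m \<longrightarrow> B i \<subseteq> B (Suc i)) \<longrightarrow>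
      (\<exists>a f (t :: nat \<Rightarrow> real). simple_flow \<A> a f \<and>
        (\<forall>i<m. t i \<in> {0..a} \<and> f (t i) = B i) \<and> (\<forall>i. Suc i < m \<longrightarrow> t i \<le> t (Suc i))))"


section \<open>Additive extensions\<close>

definition incl_excl :: "('t set \<Rightarrow> 'w \<Rightarrow> real) \<Rightarrow> nat \<Rightarrow> (nat \<Rightarrow> 't set) \<Rightarrow> 'w \<Rightarrow> real" where
  "incl_excl X n A \<omega> =
    (\<Sum>I | I \<subseteq> {..<n} \<and> I \<noteq> {}. (-1) ^ (card I + 1) * X (\<Inter>i\<in>I. A i) \<omega>)"

definition incl_excl_consistent :: "'w measure \<Rightarrow> 't set set \<Rightarrow> ('t set \<Rightarrow> 'w \<Rightarrow> real) \<Rightarrow> bool" where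
  "incl_excl_consistent M \<S> X \<longleftrightarrow>
    (\<forall>n m A A'. 0 < n \<and> 0 < m \<and> (\<forall>i<n. A i \<in> \<S>) \<and> (\<forall>j<m. A' j \<in> \<S>) \<and>
        (\<Union>i<n. A i) = (\<Union>j<m. A' j) \<longrightarrow>
      (AE \<omega> in M. incl_excl X n A \<omega> = incl_excl X m A' \<omega>))"

text \<open>
  The values of the extensions are only determined almost surely; \<open>ext_u\<close> and \<open>ext_C\<close> select one
  version, computed from some representation of the set. The lemmas below show that
  any other representation gives the same value almost surely.
\<close>

definition ext_u :: "'t set set \<Rightarrow> ('t set \<Rightarrow> 'w \<Rightarrow> real) \<Rightarrow> 't set \<Rightarrow> 'w \<Rightarrow> real" where
  "ext_u \<A> X B = (SOME Y. \<exists>n>0. \<exists>A. (\<forall>i<n. A i \<in> \<A>) \<and> B = (\<Union>i<n. A i) \<and> Y = incl_excl X n A)"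

definition ext_C :: "'t set set \<Rightarrow> ('t set \<Rightarrow> 'w \<Rightarrow> real) \<Rightarrow> 't set \<Rightarrow> 'w \<Rightarrow> real" where
  "ext_C \<A> X C = (SOME Y. \<exists>A\<in>\<A>. \<exists>B\<in>fin_unions \<A>.
      C = A - B \<and> Y = (\<lambda>\<omega>. X A \<omega> - ext_u \<A> X (A \<inter> B) \<omega>))"

definition additive_ext_u :: "'w measure \<Rightarrow> 't set set \<Rightarrow> ('t set \<Rightarrow> 'w \<Rightarrow> real) \<Rightarrow> bool" where
  "additive_ext_u M \<A> X \<longleftrightarrow> incl_excl_consistent M \<A> X"

text \<open>
  The condition on \<open>X {}\<close> expresses that the values on \<open>\<C>\<close> extend those on \<open>\<A>\<close>, as
  \<open>A = A - {}\<close> forces \<open>X A = X A - X {}\<close>.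
\<close>

definition additive_ext_C :: "'w measure \<Rightarrow> 't set set \<Rightarrow> ('t set \<Rightarrow> 'w \<Rightarrow> real) \<Rightarrow> bool" where
  "additive_ext_C M \<A> X \<longleftrightarrow> additive_ext_u M \<A> X \<and>
    (AE \<omega> in M. X {} \<omega> = 0) \<and>
    (\<forall>A\<in>\<A>. \<forall>A'\<in>\<A>. \<forall>B\<in>fin_unions \<A>. \<forall>B'\<in>fin_unions \<A>. A - B = A' - B' \<longrightarrow>
      (AE \<omega> in M. X A \<omega> - ext_u \<A> X (A \<inter> B) \<omega> = X A' \<omega> - ext_u \<A> X (A' \<inter> B') \<omega>))"

definition additive_ext_Cu :: "'w measure \<Rightarrow> 't set set \<Rightarrow> ('t set \<Rightarrow> 'w \<Rightarrow> real) \<Rightarrow> bool" where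
  "additive_ext_Cu M \<A> X \<longleftrightarrow> additive_ext_C M \<A> X \<and>
    incl_excl_consistent M (class_C \<A>) (ext_C \<A> X)"

lemma ext_u_AE:
  assumes add: "additive_ext_u M \<A> X" and n: "0 < n" and A: "\<And>i. i < n \<Longrightarrow> A i \<in> \<A>"
  shows "AE \<omega> in M. ext_u \<A> X (\<Union>i<n. A i) \<omega> = incl_excl X n A \<omega>"
proof -
  define P where "P Y \<longleftrightarrow>
    (\<exists>k>0. \<exists>A'. (\<forall>i<k. A' i \<in> \<A>) \<and> (\<Union>i<n. A i) = (\<Union>i<k. A' i) \<and> Y = incl_excl X k A')" for Y
  have "P (incl_excl X n A)"
    unfolding P_def by (intro exI[of _ n] exI[of _ A] conjI allI impI n A refl)
  then have "P (SOME Y. P Y)"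
    by (rule someI[of P])
  also have "(SOME Y. P Y) = ext_u \<A> X (\<Union>i<n. A i)"
    unfolding ext_u_def P_def ..
  finally obtain k A' where k: "0 < k" "\<forall>i<k. A' i \<in> \<A>" "(\<Union>i<n. A i) = (\<Union>i<k. A' i)"
    and eq: "ext_u \<A> X (\<Union>i<n. A i) = incl_excl X k A'"
    unfolding P_def by (elim exE conjE) (rule that)
  have "AE \<omega> in M. incl_excl X k A' \<omega> = incl_excl X n A \<omega>"
    by (rule add[unfolded additive_ext_u_def incl_excl_consistent_def, rule_format, of k n A' A])
      (intro conjI allI impI k(1) n k(2)[rule_format] A k(3)[symmetric])
  then show ?thesis
    unfolding eq .
qed

lemma ext_C_AE:
  assumes add: "additive_ext_C M \<A> X" and A: "A \<in> \<A>" and B: "B \<in> fin_unions \<A>"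
  shows "AE \<omega> in M. ext_C \<A> X (A - B) \<omega> = X A \<omega> - ext_u \<A> X (A \<inter> B) \<omega>"
proof -
  define P where "P Y \<longleftrightarrow> (\<exists>A'\<in>\<A>. \<exists>B'\<in>fin_unions \<A>.
    A - B = A' - B' \<and> Y = (\<lambda>\<omega>. X A' \<omega> - ext_u \<A> X (A' \<inter> B') \<omega>))" for Y
  have "P (\<lambda>\<omega>. X A \<omega> - ext_u \<A> X (A \<inter> B) \<omega>)"
    unfolding P_def by (intro bexI[OF _ A] bexI[OF _ B] conjI refl)
  then have "P (SOME Y. P Y)"
    by (rule someI[of P])
  also have "(SOME Y. P Y) = ext_C \<A> X (A - B)"
    unfolding ext_C_def P_def ..
  finally obtain A' B' where A': "A' \<in> \<A>" "B' \<in> fin_unions \<A>" "A - B = A' - B'"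
    and eq: "ext_C \<A> X (A - B) = (\<lambda>\<omega>. X A' \<omega> - ext_u \<A> X (A' \<inter> B') \<omega>)"
    unfolding P_def by (elim bexE conjE) (rule that)
  have "AE \<omega> in M. X A' \<omega> - ext_u \<A> X (A' \<inter> B') \<omega> = X A \<omega> - ext_u \<A> X (A \<inter> B) \<omega>"
    using add A B A' unfolding additive_ext_C_def by simp
  then show ?thesis
    unfolding eq .
qed


section \<open>Markov properties\<close>

definition sigma_rv :: "'w measure \<Rightarrow> ('w \<Rightarrow> real) \<Rightarrow> 'w measure" where
  "sigma_rv M Y = vimage_algebra (space M) Y borel"

definition min_filtration ::
    "'w measure \<Rightarrow> 't set set \<Rightarrow> ('t set \<Rightarrow> 'w \<Rightarrow> real) \<Rightarrow> 't set \<Rightarrow> 'w measure" where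
  "min_filtration M \<A> X B =
    sigma (space M) ((\<Union>A\<in>{A\<in>\<A>. A \<subseteq> B}. sets (sigma_rv M (X A))) \<union> null_sets M)"

definition cond_indep :: "'w measure \<Rightarrow> 'w measure \<Rightarrow> 'w measure \<Rightarrow> 'w measure \<Rightarrow> bool" where
  "cond_indep M F G H \<longleftrightarrow>
    (\<forall>U\<in>sets F. \<forall>V\<in>sets G. AE \<omega> in M.
      real_cond_exp M H (indicator (U \<inter> V)) \<omega> =
      real_cond_exp M H (indicator U) \<omega> * real_cond_exp M H (indicator V) \<omega>)"

definition set_Markov :: "'w measure \<Rightarrow> 't set set \<Rightarrow> ('t set \<Rightarrow> 'w \<Rightarrow> real) \<Rightarrow> bool" where
  "set_Markov M \<A> X \<longleftrightarrow> (\<forall>A\<in>\<A>. \<forall>B\<in>fin_unions \<A>.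
    cond_indep M (min_filtration M \<A> X B) (sigma_rv M (ext_C \<A> X (A - B)))
      (sigma_rv M (ext_u \<A> X B)))"

definition Markov_along ::
    "'w measure \<Rightarrow> 't set set \<Rightarrow> ('t set \<Rightarrow> 'w \<Rightarrow> real) \<Rightarrow> real \<Rightarrow> real \<Rightarrow> (real \<Rightarrow> 't set) \<Rightarrow> bool" where
  "Markov_along M \<A> X a b f \<longleftrightarrow> (\<forall>s\<in>{a..b}. \<forall>t\<in>{a..b}. s < t \<longrightarrow>
    cond_indep M (min_filtration M \<A> X (f s)) (sigma_rv M (ext_u \<A> X (f t)))
      (sigma_rv M (ext_u \<A> X (f s))))"

end

theory Submission
  imports Defs
begin

text \<open>
  Write \<open>B \<rightarrow> B'\<close> for the relation that \<open>\<F>\<^sub>B\<close> and \<open>X\<^sub>B\<^sub>'\<close> are conditionally independent given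
  \<open>X\<^sub>B\<close>. The Markov property along a flow says that \<open>f s \<rightarrow> f t\<close> for \<open>s < t\<close>. By additivity,
  \<open>X\<close> of \<open>B \<union> A\<close> is almost surely \<open>X\<^sub>B\<close> plus the increment on \<open>A - B\<close>, and adding a multiple of
  the conditioning variable does not affect conditional independence. Hence the set-Markov
  property says exactly that \<open>B \<rightarrow> B \<union> A\<close> for all \<open>A \<in> \<A>\<close> and \<open>B \<in> \<A>(u)\<close>
  (\<open>set_Markov_iff_Markov_step_Un\<close>).

  Necessity: the relation is transitive along increasing sets (\<open>Markov_step_trans\<close>), because the
  conditional probabilities given \<open>\<F>\<^sub>B\<close> can be computed through the larger \<open>\<F>\<^sub>B\<^sub>'\<close>. A set
  \<open>B' \<supseteq> B\<close> of \<open>\<A>(u)\<close> arises from \<open>B\<close> by adjoining finitely many sets of \<open>\<A>\<close> one at a time,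
  so \<open>B \<rightarrow> B'\<close>, whatever flow the two sets lie on.

  Sufficiency: if \<open>B\<close> is non-empty, the chain \<open>B \<subseteq> B \<union> A\<close> lies on a simple flow, along which the
  Markov property gives \<open>B \<rightarrow> B \<union> A\<close>. No simple flow passes through the empty set; there
  \<open>\<F>\<close> contains only events of probability 0 or 1, as \<open>X\<close> vanishes on the empty set.

  The probabilistic part rests on two reformulations of conditional independence that hold when
  the conditioning \<open>\<sigma>\<close>-algebra is contained in the past: as an identity between integrals
  (\<open>cond_indep_iff_integral\<close>), which is additive in the future event and so amenable to a
  \<open>\<pi>\<close>-\<open>\<lambda>\<close> argument, and as the statement that conditioning on the past is the same as conditioning
  on the present (\<open>cond_indep_imp_cprob_eq\<close>).
\<close>

section \<open>Conditional independence\<close>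

context prob_space
begin

abbreviation cprob :: "'a measure \<Rightarrow> 'a set \<Rightarrow> 'a \<Rightarrow> real" where
  "cprob H U \<equiv> real_cond_exp M H (indicator U)"

lemma sigma_finite_subalgebraI: "subalgebra M H \<Longrightarrow> sigma_finite_subalgebra M H"
  by (intro finite_measure_subalgebra_is_sigma_finite finite_measure_subalgebra.intro
      finite_measure_subalgebra_axioms.intro) (auto intro: finite_measure_axioms)

lemma cprob_measurable:
  "subalgebra M H \<Longrightarrow> cprob H U \<in> borel_measurable M"
  by simp

lemma cprob_bounds:
  assumes H: "subalgebra M H" and U: "U \<in> events"
  shows "AE \<omega> in M. \<bar>cprob H U \<omega>\<bar> \<le> 1"
proof -
  interpret sigma_finite_subalgebra M H by (rule sigma_finite_subalgebraI[OF H])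
  have i: "integrable M (indicator U :: _ \<Rightarrow> real)" using U by (simp add: emeasure_eq_measure)
  have "AE \<omega> in M. cprob H U \<omega> \<ge> 0"
    by (rule real_cond_exp_ge_c[OF i]) auto
  moreover have "AE \<omega> in M. cprob H U \<omega> \<le> 1"
    by (rule real_cond_exp_le_c[OF i]) (auto simp: indicator_def)
  ultimately show ?thesis by eventually_elim auto
qed

lemma integrable_mult_cprob:
  assumes H: "subalgebra M H" and U: "U \<in> events" and f: "integrable M f"
  shows "integrable M (\<lambda>\<omega>. f \<omega> * cprob H U \<omega>)"
proof (rule Bochner_Integration.integrable_bound[OF f])
  show "AE \<omega> in M. norm (f \<omega> * cprob H U \<omega>) \<le> norm (f \<omega>)"
    using cprob_bounds[OF H U] by eventually_elim (auto simp: abs_mult intro: mult_left_le)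
qed (use f cprob_measurable[OF H] in auto)

lemma integrable_mult_ind:
  assumes "U \<in> events" "integrable M (f :: 'a \<Rightarrow> real)"
  shows "integrable M (\<lambda>\<omega>. f \<omega> * indicator U \<omega>)"
  using integrable_mult_indicator[OF assms] by (simp add: mult.commute)

lemma integrable_cprob:
  "subalgebra M H \<Longrightarrow> U \<in> events \<Longrightarrow> integrable M (cprob H U)"
  using integrable_mult_cprob[of H U "\<lambda>_. 1"] by simp

lemma integral_mult_cprob:
  assumes H: "subalgebra M H" and U: "U \<in> events"
    and f: "integrable M f" "f \<in> borel_measurable H"
  shows "(\<integral>\<omega>. f \<omega> * cprob H U \<omega> \<partial>M) = (\<integral>\<omega>. f \<omega> * indicator U \<omega> \<partial>M)"
proof -
  interpret sigma_finite_subalgebra M H by (rule sigma_finite_subalgebraI[OF H])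
  show ?thesis
    by (rule real_cond_exp_intg(2)) (use U f in \<open>auto intro: integrable_mult_ind\<close>)
qed

text \<open>
  Conditional expectation is self-adjoint, so either factor may be replaced by its projection.
\<close>

lemma integral_ind_cprob:
  assumes H: "subalgebra M H" and U: "U \<in> events" and V: "V \<in> events"
  shows "(\<integral>\<omega>. indicator V \<omega> * cprob H U \<omega> \<partial>M) = (\<integral>\<omega>. cprob H U \<omega> * cprob H V \<omega> \<partial>M)"
  using integral_mult_cprob[OF H V integrable_cprob[OF H U]] by (simp add: mult.commute)

lemma integral_ind_ind:
  assumes "U \<in> events" "V \<in> events"
  shows "(\<integral>\<omega>. indicator U \<omega> * indicator V \<omega> \<partial>M) = prob (U \<inter> V)"
  using assms by (simp add: indicator_inter_arith[symmetric])

lemma cprob_charact: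
  assumes H: "subalgebra M H" and U: "U \<in> events"
    and f: "integrable M f" "f \<in> borel_measurable H"
    and eq: "\<And>W. W \<in> sets H \<Longrightarrow> prob (U \<inter> W) = (\<integral>\<omega>. indicator W \<omega> * f \<omega> \<partial>M)"
  shows "AE \<omega> in M. cprob H U \<omega> = f \<omega>"
proof -
  interpret sigma_finite_subalgebra M H by (rule sigma_finite_subalgebraI[OF H])
  show ?thesis
  proof (rule real_cond_exp_charact)
    fix W assume W: "W \<in> sets H"
    then have W': "W \<in> events" using H by (auto simp: subalgebra_def)
    show "(\<integral>\<omega>\<in>W. indicator U \<omega> \<partial>M) = (\<integral>\<omega>\<in>W. f \<omega> \<partial>M)"
      using eq[OF W] integral_ind_ind[OF U W']
      by (simp add: set_lebesgue_integral_def mult.commute)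
  qed (use U f in \<open>auto simp: emeasure_eq_measure\<close>)
qed

text \<open>
  Only one of the two events is projected in the integral. From right to left, the defining
  property of the conditional probability of \<open>U \<inter> V\<close> has to be tested against \<open>W \<in> H\<close>; since
  \<open>H \<subseteq> F\<close>, the event \<open>W\<close> can be absorbed into \<open>U\<close>.
\<close>

lemma cond_indep_iff_integral:
  assumes F: "subalgebra M F" and G: "subalgebra M G" and H: "subalgebra M H"
    and HF: "sets H \<subseteq> sets F"
  shows "cond_indep M F G H \<longleftrightarrow>
    (\<forall>U\<in>sets F. \<forall>V\<in>sets G. prob (U \<inter> V) = (\<integral>\<omega>. indicator V \<omega> * cprob H U \<omega> \<partial>M))"
    (is "_ \<longleftrightarrow> ?R")
proof -
  interpret H: sigma_finite_subalgebra M H by (rule sigma_finite_subalgebraI[OF H])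
  have Fe: "U \<in> events" if "U \<in> sets F" for U using F that by (auto simp: subalgebra_def)
  have Ge: "V \<in> events" if "V \<in> sets G" for V using G that by (auto simp: subalgebra_def)
  show ?thesis
  proof
    assume ci: "cond_indep M F G H"
    show ?R
    proof (intro ballI)
      fix U V assume UV: "U \<in> sets F" "V \<in> sets G"
      note e = Fe[OF UV(1)] Ge[OF UV(2)]
      have "(\<integral>\<omega>. indicator V \<omega> * cprob H U \<omega> \<partial>M) = (\<integral>\<omega>. cprob H U \<omega> * cprob H V \<omega> \<partial>M)"
        by (rule integral_ind_cprob[OF H e])
      also have "\<dots> = (\<integral>\<omega>. cprob H (U \<inter> V) \<omega> \<partial>M)"
      proof (rule integral_cong_AE)
        have "AE \<omega> in M. cprob H (U \<inter> V) \<omega> = cprob H U \<omega> * cprob H V \<omega>"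
          using ci UV by (simp add: cond_indep_def)
        then show "AE \<omega> in M. cprob H U \<omega> * cprob H V \<omega> = cprob H (U \<inter> V) \<omega>"
          by eventually_elim simp
      qed (use cprob_measurable[OF H] in auto)
      also have "\<dots> = (\<integral>\<omega>. indicator (U \<inter> V) \<omega> \<partial>M)"
        by (rule H.real_cond_exp_int(2)) (use e in \<open>auto simp: emeasure_eq_measure\<close>)
      also have "\<dots> = prob (U \<inter> V)" using e by simp
      finally show "prob (U \<inter> V) = (\<integral>\<omega>. indicator V \<omega> * cprob H U \<omega> \<partial>M)" ..
    qed
  next
    assume R: ?R
    show "cond_indep M F G H"
      unfolding cond_indep_def
    proof (intro ballI)
      fix U V assume UV: "U \<in> sets F" "V \<in> sets G"
      note e = Fe[OF UV(1)] Ge[OF UV(2)]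
      show "AE \<omega> in M. cprob H (U \<inter> V) \<omega> = cprob H U \<omega> * cprob H V \<omega>"
      proof (rule cprob_charact[OF H])
        fix W assume W: "W \<in> sets H"
        then have WF: "W \<in> sets F" and We: "W \<in> events" using HF Fe by auto
        have UW: "integrable M (\<lambda>\<omega>. indicator W \<omega> * cprob H U \<omega>)"
          using integrable_mult_ind[OF We integrable_cprob[OF H e(1)]] by (simp add: mult.commute)
        have "AE \<omega> in M. cprob H (U \<inter> W) \<omega> = indicator W \<omega> * cprob H U \<omega>"
        proof (rule cprob_charact[OF H _ UW])
          fix W' assume W': "W' \<in> sets H"
          then have "W' \<in> events" and i: "W' \<inter> W \<in> sets H" using W HF Fe by auto
          then have "W' \<inter> W \<in> events" using HF Fe by auto
          have "(\<integral>\<omega>. indicator W' \<omega> * (indicator W \<omega> * cprob H U \<omega>) \<partial>M)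
              = (\<integral>\<omega>. indicator (W' \<inter> W) \<omega> * cprob H U \<omega> \<partial>M)"
            by (simp add: indicator_inter_arith mult.assoc)
          also have "\<dots> = (\<integral>\<omega>. indicator (W' \<inter> W) \<omega> * indicator U \<omega> \<partial>M)"
            by (rule integral_mult_cprob[OF H e(1)])
              (use i \<open>W' \<inter> W \<in> events\<close> in \<open>auto simp: emeasure_eq_measure\<close>)
          also have "\<dots> = prob (W' \<inter> W \<inter> U)"
            by (rule integral_ind_ind) (use e \<open>W' \<inter> W \<in> events\<close> in auto)
          finally show "prob (U \<inter> W \<inter> W') = (\<integral>\<omega>. indicator W' \<omega> * (indicator W \<omega> * cprob H U \<omega>) \<partial>M)"
            by (simp add: Int_ac)
        qed (use W We e in auto)
        then have "(\<integral>\<omega>. indicator V \<omega> * cprob H (U \<inter> W) \<omega> \<partial>M)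
            = (\<integral>\<omega>. (indicator W \<omega> * cprob H U \<omega>) * indicator V \<omega> \<partial>M)"
          by (intro integral_cong_AE)
            (use e We cprob_measurable[OF H] in \<open>auto simp: mult.commute\<close>)
        also have "\<dots> = (\<integral>\<omega>. (indicator W \<omega> * cprob H U \<omega>) * cprob H V \<omega> \<partial>M)"
          by (rule integral_mult_cprob[OF H e(2) UW, symmetric]) (use W in auto)
        finally show "prob (U \<inter> V \<inter> W) = (\<integral>\<omega>. indicator W \<omega> * (cprob H U \<omega> * cprob H V \<omega>) \<partial>M)"
          using R[rule_format, of "U \<inter> W" V] UV WF by (simp add: Int_ac mult.assoc)
      qed (use e integrable_mult_cprob[OF H e(2) integrable_cprob[OF H e(1)]] in auto)
    qed
  qed
qed

text \<open>
  The Markov property in its usual form: for predicting \<open>V\<close>, the whole past \<open>F\<close> is worth no more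
  than the present \<open>H\<close>.
\<close>

lemma cond_indep_imp_cprob_eq:
  assumes F: "subalgebra M F" and G: "subalgebra M G" and H: "subalgebra M H"
    and HF: "sets H \<subseteq> sets F" and ci: "cond_indep M F G H" and V: "V \<in> sets G"
  shows "AE \<omega> in M. cprob F V \<omega> = cprob H V \<omega>"
proof -
  have Ve: "V \<in> events" using V G by (auto simp: subalgebra_def)
  have sub: "subalgebra F H" using F H HF by (auto simp: subalgebra_def)
  show ?thesis
  proof (rule cprob_charact[OF F Ve integrable_cprob[OF H Ve]])
    show "cprob H V \<in> borel_measurable F"
      by (rule measurable_from_subalg[OF sub]) simp
    fix U assume U: "U \<in> sets F"
    then have Ue: "U \<in> events" using F by (auto simp: subalgebra_def)
    show "prob (V \<inter> U) = (\<integral>\<omega>. indicator U \<omega> * cprob H V \<omega> \<partial>M)"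
      using ci[unfolded cond_indep_iff_integral[OF F G H HF]] U V
      by (simp add: Int_commute integral_ind_cprob[OF H Ve Ue] integral_ind_cprob[OF H Ue Ve] mult.commute)
  qed
qed

text \<open>
  The Chapman--Kolmogorov step, with \<open>F\<close>, \<open>H\<close> the past and present at an early time, \<open>F'\<close>, \<open>H'\<close>
  those at a later time, and \<open>G\<close> the future. The future sees \<open>F'\<close> only through \<open>H'\<close>, and \<open>H'\<close>
  sees \<open>F\<close> only through \<open>H\<close>. Projections are moved from one factor of the integral to the other
  until only the projection on \<open>H\<close> is left.
\<close>

lemma cond_indep_trans:
  assumes F: "subalgebra M F" and F': "subalgebra M F'" and G: "subalgebra M G"
    and H: "subalgebra M H" and H': "subalgebra M H'"
    and HF: "sets H \<subseteq> sets F" and HF': "sets H' \<subseteq> sets F'" and FF': "sets F \<subseteq> sets F'"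
    and ci: "cond_indep M F H' H" and ci': "cond_indep M F' G H'"
  shows "cond_indep M F G H"
  unfolding cond_indep_iff_integral[OF F G H HF]
proof (intro ballI)
  fix U V assume U: "U \<in> sets F" and V: "V \<in> sets G"
  have Ue: "U \<in> events" and Ve: "V \<in> events" using U V F G by (auto simp: subalgebra_def)
  note mH = cprob_measurable[OF H] and mH' = cprob_measurable[OF H']
    and mF' = cprob_measurable[OF F']
  have sub: "subalgebra F' H" using H F' HF FF' by (auto simp: subalgebra_def)
  have V_eq: "AE \<omega> in M. cprob F' V \<omega> = cprob H' V \<omega>"
    by (rule cond_indep_imp_cprob_eq[OF F' G H' HF' ci' V])
  have iU: "integrable M (cprob H U)" by (rule integrable_cprob[OF H Ue])
  interpret H': sigma_finite_subalgebra M H' by (rule sigma_finite_subalgebraI[OF H'])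
  \<comment> \<open>Conditioned on \<open>H'\<close>, the event \<open>U\<close> may be replaced by its conditional probability given \<open>H\<close>.\<close>
  have U_eq: "AE \<omega> in M. cprob H' U \<omega> = real_cond_exp M H' (cprob H U) \<omega>"
  proof (rule cprob_charact[OF H' Ue])
    fix W assume W: "W \<in> sets H'"
    then have We: "W \<in> events" using H' by (auto simp: subalgebra_def)
    have "prob (U \<inter> W) = (\<integral>\<omega>. indicator W \<omega> * cprob H U \<omega> \<partial>M)"
      using ci[unfolded cond_indep_iff_integral[OF F H' H HF]] U W by auto
    also have "\<dots> = (\<integral>\<omega>. indicator W \<omega> * real_cond_exp M H' (cprob H U) \<omega> \<partial>M)"
      by (rule H'.real_cond_exp_intg(2)[symmetric])
        (use W We mH integrable_mult_ind[OF We iU] in \<open>auto simp: mult.commute\<close>)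
    finally show "prob (U \<inter> W) = (\<integral>\<omega>. indicator W \<omega> * real_cond_exp M H' (cprob H U) \<omega> \<partial>M)" .
  qed (use iU in auto)
  have "prob (U \<inter> V) = (\<integral>\<omega>. indicator V \<omega> * cprob H' U \<omega> \<partial>M)"
    using ci'[unfolded cond_indep_iff_integral[OF F' G H' HF']] U V FF' by auto
  also have "\<dots> = (\<integral>\<omega>. cprob H' V \<omega> * cprob H' U \<omega> \<partial>M)"
    by (simp add: integral_ind_cprob[OF H' Ue Ve] mult.commute)
  also have "\<dots> = (\<integral>\<omega>. cprob H' V \<omega> * real_cond_exp M H' (cprob H U) \<omega> \<partial>M)"
    by (rule integral_cong_AE) (use U_eq mH' in auto)
  also have "\<dots> = (\<integral>\<omega>. cprob H' V \<omega> * cprob H U \<omega> \<partial>M)"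
    by (rule H'.real_cond_exp_intg(2))
      (use mH integrable_mult_cprob[OF H' Ve iU] in \<open>auto simp: mult.commute\<close>)
  also have "\<dots> = (\<integral>\<omega>. cprob H U \<omega> * cprob F' V \<omega> \<partial>M)"
    by (rule integral_cong_AE) (use V_eq mH' mH mF' in \<open>auto simp: mult.commute\<close>)
  also have "\<dots> = (\<integral>\<omega>. cprob H U \<omega> * indicator V \<omega> \<partial>M)"
    by (rule integral_mult_cprob[OF F' Ve iU measurable_from_subalg[OF sub]]) simp
  finally show "prob (U \<inter> V) = (\<integral>\<omega>. indicator V \<omega> * cprob H U \<omega> \<partial>M)"
    by (simp add: mult.commute)
qed

lemma cond_indep_self:
  assumes F: "subalgebra M F" and H: "subalgebra M H" and HF: "sets H \<subseteq> sets F"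
  shows "cond_indep M F H H"
  unfolding cond_indep_iff_integral[OF F H H HF]
proof (intro ballI)
  fix U V assume U: "U \<in> sets F" and V: "V \<in> sets H"
  then have e: "U \<in> events" "V \<in> events" using F H by (auto simp: subalgebra_def)
  have "(\<integral>\<omega>. indicator V \<omega> * cprob H U \<omega> \<partial>M) = (\<integral>\<omega>. indicator V \<omega> * indicator U \<omega> \<partial>M)"
    by (rule integral_mult_cprob[OF H e(1)]) (use V e in \<open>auto simp: emeasure_eq_measure\<close>)
  then show "prob (U \<inter> V) = (\<integral>\<omega>. indicator V \<omega> * cprob H U \<omega> \<partial>M)"
    using integral_ind_ind[OF e(2,1)] by (simp add: Int_commute)
qed

text \<open>
  The present may be adjoined to the future: the integral criterion holds on the intersections
  \<open>V \<inter> W\<close> of a future and a present event, because \<open>W\<close> can be moved into the past, and it is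
  stable under complements and disjoint unions.
\<close>

lemma cond_indep_adjoin:
  assumes F: "subalgebra M F" and G: "subalgebra M G" and H: "subalgebra M H" and K: "subalgebra M K"
    and HF: "sets H \<subseteq> sets F" and ci: "cond_indep M F G H"
    and KGH: "sets K \<subseteq> sigma_sets (space M) {V \<inter> W | V W. V \<in> sets G \<and> W \<in> sets H}"
  shows "cond_indep M F K H"
  unfolding cond_indep_iff_integral[OF F K H HF]
proof (intro ballI)
  let ?P = "{V \<inter> W | V W. V \<in> sets G \<and> W \<in> sets H}"
  fix U Z assume U: "U \<in> sets F" and "Z \<in> sets K"
  then have Z: "Z \<in> sigma_sets (space M) ?P" using KGH by auto
  have Ue: "U \<in> events" using U F by (auto simp: subalgebra_def)
  have Ge: "V \<in> events" if "V \<in> sets G" for V using G that by (auto simp: subalgebra_def)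
  have He: "V \<in> events" if "V \<in> sets H" for V using H that by (auto simp: subalgebra_def)
  note mH = cprob_measurable[OF H]
  have iU: "integrable M (cprob H U)" by (rule integrable_cprob[OF H Ue])
  have P: "?P \<subseteq> events" using Ge He by auto
  then have Pe: "sigma_sets (space M) ?P \<subseteq> events" by (rule sets.sigma_sets_subset)
  have st: "Int_stable ?P"
  proof (rule Int_stableI)
    fix a b assume "a \<in> ?P" "b \<in> ?P"
    then obtain V W V' W' where *: "a = V \<inter> W" "b = V' \<inter> W'" "V \<in> sets G" "W \<in> sets H" "V' \<in> sets G" "W' \<in> sets H"
      by blast
    then have "a \<inter> b = (V \<inter> V') \<inter> (W \<inter> W')" by blast
    with * show "a \<inter> b \<in> ?P" by blast
  qed
  have closed: "?P \<subseteq> Pow (space M)" using P sets.space_closed by auto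
  show "prob (U \<inter> Z) = (\<integral>\<omega>. indicator Z \<omega> * cprob H U \<omega> \<partial>M)"
    using st closed Z
  proof (induction rule: sigma_sets_induct_disjoint)
    case (basic A)
    then obtain V W where A: "A = V \<inter> W" and V: "V \<in> sets G" and W: "W \<in> sets H" by blast
    note e = Ge[OF V] He[OF W]
    have WF: "W \<in> sets F" using W HF by auto
    interpret H: sigma_finite_subalgebra M H by (rule sigma_finite_subalgebraI[OF H])
    have "AE \<omega> in M. real_cond_exp M H (\<lambda>\<omega>. indicator W \<omega> * indicator U \<omega>) \<omega> = indicator W \<omega> * cprob H U \<omega>"
      by (rule H.real_cond_exp_mult)
        (use W Ue e integrable_mult_ind[of U "indicator W"] in \<open>auto simp: emeasure_eq_measure\<close>)
    then have WU: "AE \<omega> in M. cprob H (U \<inter> W) \<omega> = indicator W \<omega> * cprob H U \<omega>"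
      by (simp add: indicator_inter_arith[symmetric] Int_commute)
    have "prob (U \<inter> W \<inter> V) = (\<integral>\<omega>. indicator V \<omega> * cprob H (U \<inter> W) \<omega> \<partial>M)"
      using ci[unfolded cond_indep_iff_integral[OF F G H HF]] U V WF by auto
    also have "\<dots> = (\<integral>\<omega>. indicator V \<omega> * (indicator W \<omega> * cprob H U \<omega>) \<partial>M)"
      by (rule integral_cong_AE) (use WU e mH in auto)
    finally show ?case
      unfolding A by (simp add: indicator_inter_arith Int_ac mult.assoc)
  next
    case empty
    then show ?case by simp
  next
    case (compl A)
    then have A: "A \<in> events" using Pe by auto
    interpret H: sigma_finite_subalgebra M H by (rule sigma_finite_subalgebraI[OF H])
    have "(\<integral>\<omega>. indicator (space M - A) \<omega> * cprob H U \<omega> \<partial>M)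
        = (\<integral>\<omega>. cprob H U \<omega> - indicator A \<omega> * cprob H U \<omega> \<partial>M)"
      by (rule Bochner_Integration.integral_cong) (auto simp: indicator_def)
    also have "\<dots> = (\<integral>\<omega>. cprob H U \<omega> \<partial>M) - prob (U \<inter> A)"
      unfolding compl
      by (rule Bochner_Integration.integral_diff)
        (use iU integrable_mult_ind[OF A iU] in \<open>auto simp: mult.commute\<close>)
    also have "(\<integral>\<omega>. cprob H U \<omega> \<partial>M) = prob U"
      using H.real_cond_exp_int(2)[of "indicator U"] Ue by (simp add: emeasure_eq_measure)
    also have "prob U - prob (U \<inter> A) = prob (U - U \<inter> A)"
      by (rule finite_measure_Diff[symmetric]) (use A Ue in auto)
    also have "U - U \<inter> A = U \<inter> (space M - A)"
      using sets.sets_into_space[OF Ue] by auto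
    finally show ?case ..
  next
    case (union A)
    have A: "A i \<in> events" for i using union Pe by auto
    have disj: "A i \<inter> A j = {}" if "i \<noteq> j" for i j
      using union(1) that by (auto simp: disjoint_family_on_def)
    have "set_integrable M (\<Union>i. A i) (cprob H U)"
      unfolding set_integrable_def by (rule integrable_mult_indicator[OF _ iU]) (use A in auto)
    then have "set_lebesgue_integral M (\<Union>i. A i) (cprob H U) = (\<Sum>i. set_lebesgue_integral M (A i) (cprob H U))"
      by (intro lebesgue_integral_countable_add A disj)
    also have "\<dots> = (\<Sum>i. prob (U \<inter> A i))"
      by (simp add: union set_lebesgue_integral_def)
    also have "\<dots> = prob (\<Union>i. U \<inter> A i)"
      by (rule sums_unique[symmetric], rule finite_measure_UNION)
        (use A Ue disj in \<open>auto simp: disjoint_family_on_def\<close>)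
    also have "(\<Union>i. U \<inter> A i) = U \<inter> (\<Union>i. A i)" by auto
    finally show ?case by (simp add: set_lebesgue_integral_def)
  qed
qed

lemma subalgebra_sigma_rv: "Y \<in> borel_measurable M \<Longrightarrow> subalgebra M (sigma_rv M Y)"
  by (auto simp: subalgebra_def sigma_rv_def dest: sets_image_in_sets[OF refl, THEN subsetD])

lemma sets_sigma_rv: "sets (sigma_rv M Y) = {Y -` S \<inter> space M | S. S \<in> sets borel}"
  unfolding sigma_rv_def by (rule sets_vimage_algebra2) auto

lemma sigma_rv_subset:
  assumes "subalgebra M F" "Y \<in> borel_measurable F"
  shows "sets (sigma_rv M Y) \<subseteq> sets F"
  using assms unfolding sigma_rv_def subalgebra_def by (intro sets_image_in_sets) auto

text \<open>
  Needed since the additive extensions are determined only up to null sets.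
\<close>

lemma cond_indep_cong_AE:
  assumes Y: "Y \<in> borel_measurable M" "Y' \<in> borel_measurable M" and eq: "AE \<omega> in M. Y \<omega> = Y' \<omega>"
    and F: "subalgebra M F" and H: "subalgebra M H"
    and ci: "cond_indep M F (sigma_rv M Y) H"
  shows "cond_indep M F (sigma_rv M Y') H"
  unfolding cond_indep_def
proof (intro ballI)
  interpret H: sigma_finite_subalgebra M H by (rule sigma_finite_subalgebraI[OF H])
  fix U V' assume U: "U \<in> sets F" and "V' \<in> sets (sigma_rv M Y')"
  then obtain S where S: "S \<in> sets borel" and V': "V' = Y' -` S \<inter> space M" by (auto simp: sets_sigma_rv)
  define V where "V = Y -` S \<inter> space M"
  have V: "V \<in> sets (sigma_rv M Y)" using S by (auto simp: V_def sets_sigma_rv)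
  have [measurable]: "V \<in> events" "V' \<in> events" "U \<in> events"
    using S Y F U unfolding V_def V' by (auto simp: subalgebra_def intro: measurable_sets)
  have "AE \<omega> in M. \<omega> \<in> V \<longleftrightarrow> \<omega> \<in> V'" using eq by eventually_elim (auto simp: V_def V')
  then have ind: "AE \<omega> in M. indicator V \<omega> = (indicator V' \<omega> :: real)"
    "AE \<omega> in M. indicator (U \<inter> V) \<omega> = (indicator (U \<inter> V') \<omega> :: real)"
    by (eventually_elim, simp add: indicator_def)+
  have "AE \<omega> in M. cprob H V \<omega> = cprob H V' \<omega>"
    "AE \<omega> in M. cprob H (U \<inter> V) \<omega> = cprob H (U \<inter> V') \<omega>"
    by (auto intro!: H.real_cond_exp_cong ind)
  moreover have "AE \<omega> in M. cprob H (U \<inter> V) \<omega> = cprob H U \<omega> * cprob H V \<omega>"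
    using ci U V by (auto simp: cond_indep_def)
  ultimately show "AE \<omega> in M. cprob H (U \<inter> V') \<omega> = cprob H U \<omega> * cprob H V' \<omega>"
    by eventually_elim auto
qed

text \<open>
  With \<open>c = 1\<close> and \<open>c = -1\<close> this passes between an increment and the value at the larger set.
\<close>

lemma cond_indep_shift:
  fixes c :: real
  assumes Y: "Y \<in> borel_measurable M" and Z: "Z \<in> borel_measurable M"
    and F: "subalgebra M F" and YF: "Y \<in> borel_measurable F"
    and ci: "cond_indep M F (sigma_rv M Z) (sigma_rv M Y)"
  shows "cond_indep M F (sigma_rv M (\<lambda>\<omega>. Z \<omega> + c * Y \<omega>)) (sigma_rv M Y)"
proof (rule cond_indep_adjoin[OF F subalgebra_sigma_rv[OF Z] subalgebra_sigma_rv[OF Y] subalgebra_sigma_rv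
      sigma_rv_subset[OF F YF] ci])
  show "(\<lambda>\<omega>. Z \<omega> + c * Y \<omega>) \<in> borel_measurable M" using Y Z by simp
  let ?P = "{V \<inter> W | V W. V \<in> sets (sigma_rv M Z) \<and> W \<in> sets (sigma_rv M Y)}"
  let ?N = "sigma (space M) ?P"
  have closed: "?P \<subseteq> Pow (space M)" by (auto simp: sets_sigma_rv)
  then have sN: "sets ?N = sigma_sets (space M) ?P" and spN: "space ?N = space M"
    by (auto simp: sets_measure_of space_measure_of)
  have borel_UNIV: "(UNIV :: real set) \<in> sets borel" by simp
  have P: "Z -` S \<inter> Y -` S' \<inter> space M \<in> sets ?N" if "S \<in> sets borel" "S' \<in> sets borel" for S S'
  proof -
    have "Z -` S \<inter> Y -` S' \<inter> space M = (Z -` S \<inter> space M) \<inter> (Y -` S' \<inter> space M)" by auto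
    also have "\<dots> \<in> ?P" using that unfolding sets_sigma_rv by blast
    finally show ?thesis unfolding sN by (rule sigma_sets.Basic)
  qed
  have "Z \<in> borel_measurable ?N"
    by (rule measurableI) (use P[of _ UNIV] in \<open>simp_all only: spN vimage_UNIV Int_UNIV_right space_borel UNIV_I borel_UNIV\<close>)
  moreover have "Y \<in> borel_measurable ?N"
    by (rule measurableI) (use P[of UNIV] in \<open>simp_all only: spN vimage_UNIV Int_UNIV_left space_borel UNIV_I borel_UNIV\<close>)
  ultimately have "(\<lambda>\<omega>. Z \<omega> + c * Y \<omega>) \<in> borel_measurable ?N" by simp
  then have "sets (sigma_rv M (\<lambda>\<omega>. Z \<omega> + c * Y \<omega>)) \<subseteq> sets ?N"
    unfolding sigma_rv_def by (rule sets_image_in_sets[OF spN[unfolded sigma_rv_def]])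
  then show "sets (sigma_rv M (\<lambda>\<omega>. Z \<omega> + c * Y \<omega>)) \<subseteq> sigma_sets (space M) ?P"
    by (simp add: sN)
qed

lemma cond_indep_trivial:
  assumes F: "subalgebra M F" and G: "subalgebra M G" and H: "subalgebra M H"
    and triv: "\<And>U. U \<in> sets F \<Longrightarrow> (AE \<omega> in M. \<omega> \<notin> U) \<or> (AE \<omega> in M. \<omega> \<in> U)"
  shows "cond_indep M F G H"
  unfolding cond_indep_def
proof (intro ballI)
  interpret H: sigma_finite_subalgebra M H by (rule sigma_finite_subalgebraI[OF H])
  fix U V assume U: "U \<in> sets F" and V: "V \<in> sets G"
  have [measurable]: "U \<in> events" "V \<in> events" using U V F G by (auto simp: subalgebra_def)
  from triv[OF U] obtain c :: real where c: "AE \<omega> in M. indicator U \<omega> = c"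
  proof
    assume "AE \<omega> in M. \<omega> \<notin> U"
    then have "AE \<omega> in M. indicator U \<omega> = (0::real)" by eventually_elim simp
    then show thesis by (rule that)
  next
    assume "AE \<omega> in M. \<omega> \<in> U"
    then have "AE \<omega> in M. indicator U \<omega> = (1::real)" by eventually_elim simp
    then show thesis by (rule that)
  qed
  have "AE \<omega> in M. cprob H U \<omega> = real_cond_exp M H (\<lambda>_. c) \<omega>"
    by (rule H.real_cond_exp_cong[OF c]) auto
  moreover have "AE \<omega> in M. real_cond_exp M H (\<lambda>_. c) \<omega> = c"
    by (rule H.real_cond_exp_F_meas) auto
  moreover have "AE \<omega> in M. cprob H (U \<inter> V) \<omega> = real_cond_exp M H (\<lambda>\<omega>. c * indicator V \<omega>) \<omega>"
  proof (rule H.real_cond_exp_cong)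
    show "AE \<omega> in M. indicator (U \<inter> V) \<omega> = c * indicator V \<omega>"
      using c by eventually_elim (simp add: indicator_inter_arith)
  qed auto
  moreover have "AE \<omega> in M. real_cond_exp M H (\<lambda>\<omega>. c * indicator V \<omega>) \<omega> = c * cprob H V \<omega>"
    by (rule H.real_cond_exp_cmult) (auto simp: emeasure_eq_measure)
  ultimately show "AE \<omega> in M. cprob H (U \<inter> V) \<omega> = cprob H U \<omega> * cprob H V \<omega>"
    by eventually_elim simp
qed

end

section \<open>Additive set-indexed processes\<close>

text \<open>
  The index sets containing \<open>n\<close>, apart from \<open>{n}\<close> itself, are the sets \<open>insert n I\<close> with \<open>I\<close>
  non-empty; their terms carry the opposite sign and intersections with \<open>A n\<close>.
\<close>

lemma incl_excl_Suc:
  "incl_excl X (Suc n) A \<omega> =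
    incl_excl X n A \<omega> + X (A n) \<omega> - incl_excl X n (\<lambda>i. A i \<inter> A n) \<omega>"
proof -
  let ?S = "{I. I \<subseteq> {..<n} \<and> I \<noteq> {}}"
  let ?t = "\<lambda>I. (-1) ^ (card I + 1) * X (\<Inter>i\<in>I. A i) \<omega>"
  have fin: "finite ?S" by simp
  have nI: "n \<notin> I" "finite I" if "I \<in> ?S" for I using that finite_subset by auto
  have eq: "{I. I \<subseteq> {..<Suc n} \<and> I \<noteq> {}} = ?S \<union> ({{n}} \<union> insert n ` ?S)" (is "?L = ?R")
  proof
    show "?L \<subseteq> ?R"
    proof
      fix I assume I: "I \<in> ?L"
      show "I \<in> ?R"
      proof (cases "n \<in> I")
        case True
        then obtain J where J: "I = insert n J" "n \<notin> J" by (rule mk_disjoint_insert[THEN exE]) blast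
        then have "J \<subseteq> {..<n}" using I by (auto simp: less_Suc_eq)
        then show ?thesis using J(1) by (cases "J = {}") auto
      next
        case False
        then show ?thesis using I by (auto simp: less_Suc_eq)
      qed
    qed
    show "?R \<subseteq> ?L" by auto
  qed
  have inj: "inj_on (insert n) ?S"
    by (rule inj_onI) (metis nI(1) insert_ident)
  have "incl_excl X (Suc n) A \<omega> = sum ?t ?S + (sum ?t {{n}} + sum ?t (insert n ` ?S))"
  proof -
    have "sum ?t ({{n}} \<union> insert n ` ?S) = sum ?t {{n}} + sum ?t (insert n ` ?S)"
      by (rule sum.union_disjoint) (use fin nI(1) in auto)
    moreover have "sum ?t (?S \<union> ({{n}} \<union> insert n ` ?S)) = sum ?t ?S + sum ?t ({{n}} \<union> insert n ` ?S)"
      by (rule sum.union_disjoint) (use fin in auto)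
    ultimately show ?thesis unfolding incl_excl_def eq by simp
  qed
  also have "sum ?t (insert n ` ?S) = (\<Sum>I\<in>?S. ?t (insert n I))"
    by (rule sum.reindex_cong[OF inj]) auto
  also have "\<dots> = (\<Sum>I\<in>?S. - ((-1) ^ (card I + 1) * X (\<Inter>i\<in>I. A i \<inter> A n) \<omega>))"
  proof (rule sum.cong[OF refl])
    fix I assume I: "I \<in> ?S"
    then have "(\<Inter>i\<in>insert n I. A i) = (\<Inter>i\<in>I. A i \<inter> A n)" by auto
    then show "?t (insert n I) = - ((-1) ^ (card I + 1) * X (\<Inter>i\<in>I. A i \<inter> A n) \<omega>)"
      using nI[OF I] by simp
  qed
  finally show ?thesis
    by (simp add: incl_excl_def sum_negf)
qed

locale additive_process = prob_space M for M :: "'w measure" +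
  fixes \<A> :: "'t set set" and X :: "'t set \<Rightarrow> 'w \<Rightarrow> real"
  assumes empty_in: "{} \<in> \<A>"
    and Int_in: "A \<in> \<A> \<Longrightarrow> A' \<in> \<A> \<Longrightarrow> A \<inter> A' \<in> \<A>"
    and X_measurable: "A \<in> \<A> \<Longrightarrow> X A \<in> borel_measurable M"
    and additive: "additive_ext_C M \<A> X"
begin

abbreviation \<F> where "\<F> \<equiv> min_filtration M \<A> X"
abbreviation Xu where "Xu \<equiv> ext_u \<A> X"
abbreviation XC where "XC \<equiv> ext_C \<A> X"

lemma additive_u: "additive_ext_u M \<A> X"
  using additive by (simp add: additive_ext_C_def)

text \<open>
  Putting the empty set in front makes the enumeration non-empty also for the empty union, as
  inclusion--exclusion sums are only considered for at least one set.
\<close>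

lemma fin_unions_rep:
  assumes "B \<in> fin_unions \<A>"
  shows "\<exists>n>0. \<exists>A :: nat \<Rightarrow> 't set. (\<forall>i<n. A i \<in> \<A>) \<and> B = (\<Union>i<n. A i)"
proof -
  obtain \<S> where S: "finite \<S>" "\<S> \<subseteq> \<A>" "B = \<Union>\<S>" using assms by (auto simp: fin_unions_def)
  obtain n :: nat and e where e: "insert {} \<S> = e ` {i. i < n}"
    using finite_imp_nat_seg_image_inj_on[of "insert {} \<S>"] S(1) by auto
  have "0 < n" using e by (cases "n = 0") simp_all
  moreover have "e i \<in> \<A>" if "i < n" for i
  proof -
    have "e i \<in> insert {} \<S>" unfolding e using that by simp
    then show ?thesis using S(2) empty_in by auto
  qed
  moreover have "B = (\<Union>i<n. e i)"
  proof -
    have "B = \<Union>(insert {} \<S>)" using S(3) by simp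
    then show ?thesis by (simp only: e lessThan_def)
  qed
  ultimately show ?thesis by blast
qed

lemma fin_unionsI: "A \<in> \<A> \<Longrightarrow> A \<in> fin_unions \<A>"
  unfolding fin_unions_def by (rule CollectI, rule exI[of _ "{A}"]) auto

lemma fin_unions_UN: "(\<And>i. i < n \<Longrightarrow> A i \<in> \<A>) \<Longrightarrow> (\<Union>i<n. A i) \<in> fin_unions \<A>" for n :: nat
  unfolding fin_unions_def by (rule CollectI, rule exI[of _ "A ` {..<n}"]) auto

lemma fin_unions_Un:
  assumes "B \<in> fin_unions \<A>" "B' \<in> fin_unions \<A>"
  shows "B \<union> B' \<in> fin_unions \<A>"
proof -
  obtain \<S> \<S>' where "finite \<S>" "\<S> \<subseteq> \<A>" "B = \<Union>\<S>" "finite \<S>'" "\<S>' \<subseteq> \<A>" "B' = \<Union>\<S>'"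
    using assms by (auto simp: fin_unions_def)
  then show ?thesis
    unfolding fin_unions_def by (intro CollectI exI[of _ "\<S> \<union> \<S>'"]) simp
qed

lemma fin_unions_Int:
  assumes "A \<in> \<A>" "B \<in> fin_unions \<A>"
  shows "A \<inter> B \<in> fin_unions \<A>"
proof -
  obtain n :: nat and C where C: "\<forall>i<n. C i \<in> \<A>" and BC: "B = (\<Union>i<n. C i)"
    using fin_unions_rep[OF assms(2)] by blast
  have "A \<inter> B = (\<Union>i<n. A \<inter> C i)" unfolding BC by (rule Int_UN_distrib)
  also have "\<dots> \<in> fin_unions \<A>" by (intro fin_unions_UN Int_in assms(1) C[rule_format])
  finally show ?thesis .
qed

lemma Inter_in: "finite I \<Longrightarrow> I \<noteq> {} \<Longrightarrow> (\<And>i. i \<in> I \<Longrightarrow> A i \<in> \<A>) \<Longrightarrow> (\<Inter>i\<in>I. A i) \<in> \<A>"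
  by (induction I rule: finite_ne_induct) (auto intro: Int_in)

lemma min_filtration_generators:
  "(\<Union>A\<in>{A\<in>\<A>. A \<subseteq> B}. sets (sigma_rv M (X A))) \<union> null_sets M \<subseteq> sets M"
  using subalgebra_sigma_rv[OF X_measurable] by (auto simp: subalgebra_def)

lemma sets_min_filtration:
  "sets (\<F> B) = sigma_sets (space M) ((\<Union>A\<in>{A\<in>\<A>. A \<subseteq> B}. sets (sigma_rv M (X A))) \<union> null_sets M)"
  unfolding min_filtration_def
  by (rule sets_measure_of) (rule subset_trans[OF min_filtration_generators sets.space_closed])

lemma subalgebra_min_filtration: "subalgebra M (\<F> B)"
  unfolding subalgebra_def sets_min_filtration
  using sets.sigma_sets_subset[OF min_filtration_generators]
  by (auto simp: min_filtration_def space_measure_of_conv)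

lemma min_filtration_mono: "B \<subseteq> B' \<Longrightarrow> sets (\<F> B) \<subseteq> sets (\<F> B')"
  unfolding sets_min_filtration by (rule sigma_sets_mono') auto

lemma X_min_filtration:
  assumes "A \<in> \<A>" "A \<subseteq> B"
  shows "X A \<in> borel_measurable (\<F> B)"
proof (rule measurableI)
  fix S :: "real set" assume "S \<in> sets borel"
  then have "X A -` S \<inter> space M \<in> sets (\<F> B)"
    unfolding sets_min_filtration using assms by (intro sigma_sets.Basic) (auto simp: sets_sigma_rv)
  then show "X A -` S \<inter> space (\<F> B) \<in> sets (\<F> B)"
    using subalgebra_min_filtration by (simp add: subalgebra_def)
qed simp

text \<open>
  The selected version is itself an inclusion--exclusion sum over subsets of \<open>B\<close> in \<open>\<A>\<close>, so it is
  measurable as it stands and not just up to a null set.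
\<close>

lemma ext_u_min_filtration:
  assumes B: "B \<in> fin_unions \<A>"
  shows "Xu B \<in> borel_measurable (\<F> B)"
proof -
  let ?P = "\<lambda>Y. \<exists>n>0. \<exists>A. (\<forall>i<n. A i \<in> \<A>) \<and> B = (\<Union>i<n. A i) \<and> Y = incl_excl X n A"
  have "\<exists>Y. ?P Y"
    using fin_unions_rep[OF B] by blast
  then have "?P (Xu B)" unfolding ext_u_def by (rule someI_ex)
  then obtain n A where n: "0 < n" "\<forall>i<n. A i \<in> \<A>" "B = (\<Union>i<n. A i)" and eq: "Xu B = incl_excl X n A"
    by blast
  have "X (\<Inter>i\<in>I. A i) \<in> borel_measurable (\<F> B)" if I: "I \<subseteq> {..<n}" "I \<noteq> {}" for I
  proof (rule X_min_filtration)
    show "(\<Inter>i\<in>I. A i) \<in> \<A>" using I n(2) by (intro Inter_in) (auto intro: finite_subset)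
    show "(\<Inter>i\<in>I. A i) \<subseteq> B" using I n(3) by blast
  qed
  then have "(\<lambda>\<omega>. incl_excl X n A \<omega>) \<in> borel_measurable (\<F> B)"
    unfolding incl_excl_def by (intro borel_measurable_sum borel_measurable_times) auto
  then show ?thesis unfolding eq .
qed

lemma ext_u_measurable: "B \<in> fin_unions \<A> \<Longrightarrow> Xu B \<in> borel_measurable M"
  using measurable_from_subalg[OF subalgebra_min_filtration ext_u_min_filtration] .

lemma ext_C_measurable:
  assumes A: "A \<in> \<A>" and B: "B \<in> fin_unions \<A>"
  shows "XC (A - B) \<in> borel_measurable M"
proof -
  let ?P = "\<lambda>Y. \<exists>A'\<in>\<A>. \<exists>B'\<in>fin_unions \<A>. A - B = A' - B' \<and> Y = (\<lambda>\<omega>. X A' \<omega> - Xu (A' \<inter> B') \<omega>)"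
  have "\<exists>Y. ?P Y" using A B by blast
  then have "?P (XC (A - B))" unfolding ext_C_def by (rule someI_ex)
  then obtain A' B' where "A' \<in> \<A>" "B' \<in> fin_unions \<A>" "XC (A - B) = (\<lambda>\<omega>. X A' \<omega> - Xu (A' \<inter> B') \<omega>)"
    by blast
  then show ?thesis
    using X_measurable ext_u_measurable[OF fin_unions_Int] by simp
qed

text \<open>
  Take a representation of \<open>B\<close> and append \<open>A\<close>: by \<open>incl_excl_Suc\<close> the sum grows by \<open>X A\<close> and
  loses the sum for \<open>A \<inter> B\<close>, which is the value on \<open>A - B\<close>.
\<close>

lemma ext_u_Un:
  assumes A: "A \<in> \<A>" and B: "B \<in> fin_unions \<A>"
  shows "AE \<omega> in M. Xu (B \<union> A) \<omega> = Xu B \<omega> + XC (A - B) \<omega>"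
proof -
  obtain n :: nat and C where n: "0 < n" and C: "\<forall>i<n. C i \<in> \<A>" and BC: "B = (\<Union>i<n. C i)"
    using fin_unions_rep[OF B] by blast
  define D where "D = C(n := A)"
  have D: "\<And>i. i < Suc n \<Longrightarrow> D i \<in> \<A>" using A C by (auto simp: D_def less_Suc_eq)
  have Dn: "D n = A" and DC: "\<And>i. i < n \<Longrightarrow> D i = C i" by (auto simp: D_def)
  have sets: "(\<Union>i<Suc n. D i) = B \<union> A" "(\<Union>i<n. D i) = B" "(\<Union>i<n. D i \<inter> A) = A \<inter> B"
    unfolding BC lessThan_Suc using Dn DC by auto
  have "AE \<omega> in M. Xu (\<Union>i<Suc n. D i) \<omega> = incl_excl X (Suc n) D \<omega>"
    by (rule ext_u_AE[OF additive_u]) (use D in auto)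
  moreover have "AE \<omega> in M. Xu (\<Union>i<n. D i) \<omega> = incl_excl X n D \<omega>"
    by (rule ext_u_AE[OF additive_u n]) (use D in auto)
  moreover have "AE \<omega> in M. Xu (\<Union>i<n. D i \<inter> A) \<omega> = incl_excl X n (\<lambda>i. D i \<inter> A) \<omega>"
    by (rule ext_u_AE[OF additive_u n]) (use D A Int_in in auto)
  moreover have "AE \<omega> in M. XC (A - B) \<omega> = X A \<omega> - Xu (A \<inter> B) \<omega>"
    by (rule ext_C_AE[OF additive A B])
  ultimately show ?thesis
    unfolding sets by eventually_elim (simp add: incl_excl_Suc Dn)
qed

text \<open>
  The only set of \<open>\<A>\<close> inside \<open>{}\<close> is \<open>{}\<close>, where \<open>X\<close> vanishes almost surely.
\<close>

lemma min_filtration_empty_trivial: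
  assumes "U \<in> sets (\<F> {})"
  shows "(AE \<omega> in M. \<omega> \<notin> U) \<or> (AE \<omega> in M. \<omega> \<in> U)"
  using assms unfolding sets_min_filtration
proof (induction rule: sigma_sets.induct)
  case (Basic U)
  then consider "U \<in> sets (sigma_rv M (X {}))" | "U \<in> null_sets M" by auto
  then show ?case
  proof cases
    case 1
    then obtain S where U: "U = X {} -` S \<inter> space M" by (auto simp: sets_sigma_rv)
    have "AE \<omega> in M. X {} \<omega> = 0" using additive by (simp add: additive_ext_C_def)
    then have "AE \<omega> in M. \<omega> \<in> U \<longleftrightarrow> 0 \<in> S"
      using AE_space by eventually_elim (auto simp: U)
    then show ?thesis by (cases "0 \<in> S") auto
  next
    case 2
    then show ?thesis using AE_not_in by auto
  qed
next
  case Empty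
  then show ?case by simp
next
  case (Compl U)
  then show ?case by auto
next
  case (Union U)
  show ?case
  proof (cases "\<exists>i. AE \<omega> in M. \<omega> \<in> U i")
    case True
    then obtain i where "AE \<omega> in M. \<omega> \<in> U i" ..
    then have "AE \<omega> in M. \<omega> \<in> (\<Union>i. U i)" by eventually_elim auto
    then show ?thesis ..
  next
    case False
    then have "\<forall>i. AE \<omega> in M. \<omega> \<notin> U i" using Union by blast
    then show ?thesis unfolding AE_all_countable[symmetric] by auto
  qed
qed


section \<open>The Markov relation between finite unions\<close>

abbreviation Markov_step :: "'t set \<Rightarrow> 't set \<Rightarrow> bool" where
  "Markov_step B B' \<equiv> cond_indep M (\<F> B) (sigma_rv M (Xu B')) (sigma_rv M (Xu B))"

lemma Markov_step_iff_increment: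
  assumes A: "A \<in> \<A>" and B: "B \<in> fin_unions \<A>"
  shows "Markov_step B (B \<union> A) \<longleftrightarrow>
    cond_indep M (\<F> B) (sigma_rv M (XC (A - B))) (sigma_rv M (Xu B))"
proof -
  have BA: "B \<union> A \<in> fin_unions \<A>" using fin_unions_Un[OF B fin_unionsI[OF A]] .
  note mB = ext_u_measurable[OF B] and mBA = ext_u_measurable[OF BA] and mC = ext_C_measurable[OF A B]
  note add = ext_u_Un[OF A B]
  note F = subalgebra_min_filtration[of B] and H = subalgebra_sigma_rv[OF ext_u_measurable[OF B]]
    and BF = ext_u_min_filtration[OF B]
  show ?thesis
  proof
    assume "Markov_step B (B \<union> A)"
    then have "cond_indep M (\<F> B) (sigma_rv M (\<lambda>\<omega>. Xu (B \<union> A) \<omega> + (-1) * Xu B \<omega>)) (sigma_rv M (Xu B))"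
      by (rule cond_indep_shift[OF mB mBA F BF])
    then show "cond_indep M (\<F> B) (sigma_rv M (XC (A - B))) (sigma_rv M (Xu B))"
    proof (rule cond_indep_cong_AE[OF _ mC _ F H, rotated 2])
      show "AE \<omega> in M. Xu (B \<union> A) \<omega> + (-1) * Xu B \<omega> = XC (A - B) \<omega>"
        using add by eventually_elim simp
    qed (intro borel_measurable_add borel_measurable_times borel_measurable_const mB mBA)
  next
    assume "cond_indep M (\<F> B) (sigma_rv M (XC (A - B))) (sigma_rv M (Xu B))"
    then have "cond_indep M (\<F> B) (sigma_rv M (\<lambda>\<omega>. XC (A - B) \<omega> + 1 * Xu B \<omega>)) (sigma_rv M (Xu B))"
      by (rule cond_indep_shift[OF mB mC F BF])
    then show "Markov_step B (B \<union> A)"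
    proof (rule cond_indep_cong_AE[OF _ mBA _ F H, rotated 2])
      show "AE \<omega> in M. XC (A - B) \<omega> + 1 * Xu B \<omega> = Xu (B \<union> A) \<omega>"
        using add by eventually_elim simp
    qed (intro borel_measurable_add borel_measurable_times borel_measurable_const mB mC)
  qed
qed

text \<open>
  The empty set is the one member of \<open>fin_unions \<A>\<close> that simple flows cannot reach.
\<close>

lemma Markov_step_empty: "B \<in> fin_unions \<A> \<Longrightarrow> Markov_step {} B"
  using fin_unionsI[OF empty_in]
  by (intro cond_indep_trivial subalgebra_min_filtration subalgebra_sigma_rv ext_u_measurable
      min_filtration_empty_trivial)

lemma Markov_step_refl: "B \<in> fin_unions \<A> \<Longrightarrow> Markov_step B B"
  by (intro cond_indep_self subalgebra_min_filtration subalgebra_sigma_rv ext_u_measurable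
      sigma_rv_subset ext_u_min_filtration)

lemma Markov_step_trans:
  assumes "B \<in> fin_unions \<A>" "B' \<in> fin_unions \<A>" "B'' \<in> fin_unions \<A>" "B \<subseteq> B'"
    and "Markov_step B B'" "Markov_step B' B''"
  shows "Markov_step B B''"
  by (rule cond_indep_trans[where F' = "\<F> B'" and H' = "sigma_rv M (Xu B')"])
    (intro subalgebra_min_filtration subalgebra_sigma_rv ext_u_measurable
      sigma_rv_subset ext_u_min_filtration min_filtration_mono assms)+

lemma set_Markov_iff_Markov_step_Un:
  "set_Markov M \<A> X \<longleftrightarrow> (\<forall>A\<in>\<A>. \<forall>B\<in>fin_unions \<A>. Markov_step B (B \<union> A))"
  by (simp add: set_Markov_def Markov_step_iff_increment)

text \<open>
  The members of a finite family with union \<open>B'\<close> are adjoined to \<open>B\<close> one after the other.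
\<close>

lemma set_Markov_imp_Markov_step:
  assumes sM: "set_Markov M \<A> X" and B: "B \<in> fin_unions \<A>" and B': "B' \<in> fin_unions \<A>" and sub: "B \<subseteq> B'"
  shows "Markov_step B B'"
proof -
  obtain \<S> where S: "finite \<S>" "\<S> \<subseteq> \<A>" "B' = \<Union>\<S>" using B' by (auto simp: fin_unions_def)
  have "B \<union> \<Union>\<S> \<in> fin_unions \<A> \<and> Markov_step B (B \<union> \<Union>\<S>)" using S(1,2)
  proof (induction \<S> rule: finite_induct)
    case empty
    then show ?case using B Markov_step_refl by simp
  next
    case (insert A \<S>)
    then have A: "A \<in> \<A>" and IH: "B \<union> \<Union>\<S> \<in> fin_unions \<A>" "Markov_step B (B \<union> \<Union>\<S>)" by auto
    have eq: "B \<union> \<Union>(insert A \<S>) = B \<union> \<Union>\<S> \<union> A" by auto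
    have "B \<union> \<Union>\<S> \<union> A \<in> fin_unions \<A>" using fin_unions_Un[OF IH(1) fin_unionsI[OF A]] .
    moreover have "Markov_step (B \<union> \<Union>\<S>) (B \<union> \<Union>\<S> \<union> A)"
      using sM[unfolded set_Markov_iff_Markov_step_Un] A IH(1) by blast
    ultimately show ?case
      unfolding eq by (intro conjI Markov_step_trans[OF B IH(1) _ Un_upper1 IH(2)])
  qed
  moreover have "B \<union> \<Union>\<S> = B'" using S(3) sub by auto
  ultimately show ?thesis by simp
qed

section \<open>Flows\<close>

lemma set_Markov_imp_Markov_along:
  assumes "set_Markov M \<A> X" "flow (fin_unions \<A>) a b f"
  shows "Markov_along M \<A> X a b f"
  unfolding Markov_along_def
proof (intro ballI impI set_Markov_imp_Markov_step assms(1))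
  fix s t assume st: "s \<in> {a..b}" "t \<in> {a..b}" "s < t"
  have f: "f \<in> {a..b} \<rightarrow> fin_unions \<A>" "mono_on {a..b} f"
    using assms(2) by (simp_all add: flow_def)
  show "f s \<in> fin_unions \<A>" "f t \<in> fin_unions \<A>" using f(1) st(1,2) by (auto dest: funcset_mem)
  show "f s \<subseteq> f t" using st by (intro mono_onD[OF f(2)]) auto
qed

end

lemma chain_on_simple_flow:
  assumes "chains_on_simple_flows \<A>"
    and "B \<in> fin_unions \<A>" "B' \<in> fin_unions \<A>" "B \<noteq> {}" "B \<subseteq> B'"
  obtains a f s t where "simple_flow \<A> a f" "s \<in> {0..a}" "t \<in> {0..a}" "s \<le> t" "f s = B" "f t = B'"
proof -
  define C where "C = (\<lambda>i::nat. if i = 0 then B else B')"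
  have C: "C 0 = B" "C 1 = B'" by (simp_all add: C_def)
  have two: "(\<forall>i<2. P i) \<longleftrightarrow> P 0 \<and> P 1" for P :: "nat \<Rightarrow> bool"
    by (auto simp: less_2_cases_iff)
  have "(0::nat) < 2 \<and> (\<forall>i<2. C i \<in> fin_unions \<A> \<and> C i \<noteq> {}) \<and> (\<forall>i. Suc i < 2 \<longrightarrow> C i \<subseteq> C (Suc i))"
    using assms(2-5) by (auto simp: two C C(2)[simplified])
  from assms(1)[unfolded chains_on_simple_flows_def, rule_format, OF this]
  obtain a f and t :: "nat \<Rightarrow> real" where f: "simple_flow \<A> a f"
    and t: "\<forall>i<2. t i \<in> {0..a} \<and> f (t i) = C i" "\<forall>i. Suc i < 2 \<longrightarrow> t i \<le> t (Suc i)"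
    by (elim exE conjE)
  show thesis
  proof (rule that[OF f])
    show "t 0 \<in> {0..a}" "t 1 \<in> {0..a}" "f (t 0) = B" "f (t 1) = B'"
      using t(1) unfolding two C by blast+
    show "t 0 \<le> t 1" using t(2)[rule_format, of 0] by simp
  qed
qed

theorem proposition2:
  fixes \<A> :: "'t::t2_space set set"
    and M :: "'w measure"
    and X :: "'t set \<Rightarrow> 'w \<Rightarrow> real"
  assumes "indexing_collection \<A>"
    and "chains_on_simple_flows \<A>"
    and "prob_space M"
    and "complete_measure M"
    and "\<And>A. A \<in> \<A> \<Longrightarrow> X A \<in> borel_measurable M"
    and "additive_ext_Cu M \<A> X"
  shows "(set_Markov M \<A> X \<longleftrightarrow>
      (\<forall>a f. simple_flow \<A> a f \<longrightarrow> Markov_along M \<A> X 0 a f)) \<and>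
    (set_Markov M \<A> X \<longrightarrow>
      (\<forall>a b f. flow (fin_unions \<A>) a b f \<longrightarrow> Markov_along M \<A> X a b f))"
proof -
  interpret prob_space M by fact
  interpret additive_process M \<A> X
  proof
    fix A A' assume "A \<in> \<A>" "A' \<in> \<A>"
    then have "{A, A'} \<subseteq> \<A> \<and> {A, A'} \<noteq> {}" by auto
    then have "\<Inter>{A, A'} \<in> \<A>"
      using assms(1) unfolding indexing_collection_def by meson
    then show "A \<inter> A' \<in> \<A>" by simp
  qed (use assms in \<open>auto simp: indexing_collection_def additive_ext_Cu_def\<close>)
  have "set_Markov M \<A> X" if sf: "\<forall>a f. simple_flow \<A> a f \<longrightarrow> Markov_along M \<A> X 0 a f"
    unfolding set_Markov_iff_Markov_step_Un
  proof (intro ballI)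
    fix A B assume A: "A \<in> \<A>" and B: "B \<in> fin_unions \<A>"
    note BA = fin_unions_Un[OF B fin_unionsI[OF A]]
    show "Markov_step B (B \<union> A)"
    proof (cases "B = {}")
      case True
      then show ?thesis using Markov_step_empty[OF BA] by simp
    next
      case False
      obtain a f s t where f: "simple_flow \<A> a f" and st: "s \<in> {0..a}" "t \<in> {0..a}" "s \<le> t"
        and fst: "f s = B" "f t = B \<union> A"
        by (rule chain_on_simple_flow[OF assms(2) B BA False]) auto
      show ?thesis
      proof (cases "s = t")
        \<comment> \<open>This occurs only for \<open>A \<subseteq> B\<close>, where the increment is trivial.\<close>
        case True
        then show ?thesis using fst Markov_step_refl[OF B] by simp
      next
        case False
        moreover have "Markov_along M \<A> X 0 a f" using sf f by simp
        ultimately have "Markov_step (f s) (f t)" using st by (simp add: Markov_along_def)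
        then show ?thesis by (simp only: fst)
      qed
    qed
  qed
  moreover have "flow (fin_unions \<A>) 0 a f" if "simple_flow \<A> a f" for a f
    using that by (simp add: simple_flow_def continuous_flow_def)
  ultimately show ?thesis
    using set_Markov_imp_Markov_along by blast
qed

end
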